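(* For every integer $g\geq 3$, the set of base-$g$ Niven numbers is an asymptotic basis of order $3$: there exists $N_0=N_0(g)$ such that every integer $M\geq N_0$ can be written as $M=n_1+n_2+n_3$ with $n_1,n_2,n_3$ base-$g$ Niven numbers.
   Context: For an integer $g\geq 2$, $s_g(n)$ denotes the sum of the base-$g$ digits of a natural number $n$. A base-$g$ Niven number is a natural number $n\geq 1$ that is divisible by $s_g(n)$. *)

theory Defs
  imports Complex_Main
begin

text \<open>The guard \<open>g < 2\<close> only makes the function total; the digit sum is meant for bases
  \<open>g \<ge> 2\<close>.\<close>

function digit_sum :: "nat \<Rightarrow> nat \<Rightarrow> nat" where
  "digit_sum g n = (if g < 2 \<or> n = 0 then 0 else n mod g + digit_sum g (n div g))"
  by auto
termination
  by (relation "measure snd") auto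

declare digit_sum.simps [simp del]

definition niven :: "nat \<Rightarrow> nat \<Rightarrow> bool" where
  "niven g n \<longleftrightarrow> n \<ge> 1 \<and> digit_sum g n dvd n"

end

theory Submission
  imports Defs "HOL-Number_Theory.Cong"
begin

text \<open>
  Prescribing the digit sum \<open>k\<close> leaves a number free to lie in any residue class modulo a small
  \<open>Q\<close> (subject to \<open>n \<equiv> k\<close> modulo \<open>g - 1\<close>): add a suitable shift of
  \<open>Q (g^j - 1)\<close>, whose digit sum is \<open>(g - 1) j\<close> for every \<open>j\<close> with \<open>Q \<le> g^j\<close>.
  With this one picks a short Niven number \<open>n\<close> with \<open>n \<equiv> M\<close> modulo a chosen
  \<open>D\<close>, such that \<open>X = M - n\<close> ends in a block of digits \<open>g - 1\<close> preceded by a zero.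
  The part of \<open>X\<close> above the block is split into two numbers of equal digit sum, the number of
  carries being freely adjustable, so that both summands of \<open>X\<close> get digit sum exactly
  \<open>D\<close>. Inside the block the digits of the first summand are arbitrary, so it can be made
  divisible by \<open>D\<close> without changing its digit sum; the second summand is then divisible by
  \<open>D\<close> as well, because \<open>X\<close> is.
\<close>

lemma coprime_mult_add_one_nat: "coprime (m * q + 1) m" for m q :: nat
proof (rule coprimeI)
  fix d assume "d dvd m * q + 1" "d dvd m"
  then show "is_unit d" using dvd_add_right_iff[of d "m * q" 1] by simp
qed

section \<open>Digit sums in base \<open>g\<close>: blocks, residues modulo \<open>g - 1\<close>,
  complements\<close>

context
  fixes g :: nat
  assumes g2: "g \<ge> 2"
begin

lemma digit_sum_0 [simp]: "digit_sum g 0 = 0"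
  by (simp add: digit_sum.simps)

lemma digit_sum_mult_add: "r < g \<Longrightarrow> digit_sum g (g * q + r) = digit_sum g q + r"
  using g2 by (subst digit_sum.simps) auto

lemma digit_sum_power_mult_add:
  "r < g ^ n \<Longrightarrow> digit_sum g (g ^ n * q + r) = digit_sum g q + digit_sum g r"
proof (induction n arbitrary: r)
  case 0
  then show ?case by simp
next
  case (Suc n)
  have lt: "r mod g < g" using g2 by simp
  have "r div g < g ^ n"
    using Suc.prems g2 by (simp add: less_mult_imp_div_less mult.commute)
  note IH = Suc.IH[OF this]
  have "g ^ Suc n * q + r = g * (g ^ n * q + r div g) + r mod g"
    by (simp add: algebra_simps)
  then have "digit_sum g (g ^ Suc n * q + r) = digit_sum g (g ^ n * q + r div g) + r mod g"
    using digit_sum_mult_add[OF lt] by simp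
  also have "\<dots> = digit_sum g q + (digit_sum g (r div g) + r mod g)"
    using IH by simp
  also have "digit_sum g (r div g) + r mod g = digit_sum g r"
    using digit_sum_mult_add[OF lt, of "r div g"] by simp
  finally show ?case .
qed

lemma digit_sum_split:
  "digit_sum g n = digit_sum g (n div g ^ k) + digit_sum g (n mod g ^ k)"
  using digit_sum_power_mult_add[of "n mod g ^ k" k "n div g ^ k"] g2 by simp

lemma cong_base_1: "[g = 1] (mod (g - 1))"
  using g2 by (simp add: cong_altdef_nat)

lemma cong_digit_sum: "[digit_sum g n = n] (mod (g - 1))"
proof (induction n rule: less_induct)
  case (less n)
  show ?case
  proof (cases "n = 0")
    case False
    then have "n div g < n" using g2 by simp
    note IH = less.IH[OF this]
    have "digit_sum g n = digit_sum g (n div g) + n mod g"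
      using digit_sum_mult_add[of "n mod g" "n div g"] g2 by simp
    moreover have "[digit_sum g (n div g) + n mod g = 1 * (n div g) + n mod g] (mod (g - 1))"
      using IH by (simp add: cong_add_rcancel_nat)
    moreover have "[1 * (n div g) + n mod g = g * (n div g) + n mod g] (mod (g - 1))"
      using cong_base_1 by (intro cong_add cong_mult) (auto simp: cong_sym_eq)
    ultimately show ?thesis by (metis cong_trans mult_div_mod_eq)
  qed simp
qed

text \<open>Subtracting from a number with all digits \<open>g - 1\<close> never borrows: each digit
  \<open>r\<close> turns into \<open>g - 1 - r\<close>.\<close>

lemma digit_sum_complement:
  "v < g ^ n \<Longrightarrow> digit_sum g (g ^ n - 1 - v) + digit_sum g v = (g - 1) * n"
proof (induction n arbitrary: v)
  case 0
  then show ?case by simp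
next
  case (Suc n)
  define q r where "q = v div g" and "r = v mod g"
  have v: "v = g * q + r" and r: "r < g" using g2 by (auto simp: q_def r_def)
  have q: "q < g ^ n"
    using Suc.prems g2 by (simp add: q_def less_mult_imp_div_less mult.commute)
  obtain d where d: "g ^ n = q + 1 + d" using less_imp_Suc_add[OF q] by auto
  obtain e where e: "g = r + 1 + e" using less_imp_Suc_add[OF r] by auto
  have "g ^ Suc n = (g * d + e) + 1 + v"
    using d e v by (simp add: distrib_left)
  then have "g ^ Suc n - 1 - v = g * d + e" by simp
  moreover have "g ^ n - 1 - q = d" using d by simp
  ultimately show ?case
    using Suc.IH[OF q] digit_sum_mult_add[of e d] digit_sum_mult_add[OF r, of q] v e
    by (simp add: algebra_simps)
qed

lemma digit_sum_power_minus_1: "digit_sum g (g ^ n - 1) = (g - 1) * n"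
  using digit_sum_complement[of 0 n] g2 by simp

lemma digit_sum_le: "v < g ^ n \<Longrightarrow> digit_sum g v \<le> (g - 1) * n"
  using digit_sum_complement[of v n] by simp

section \<open>Numbers with prescribed digit sum and residue\<close>

text \<open>The upper block of the product is \<open>Q - 1\<close> and the lower block its
  complement in \<open>j\<close> digits, so the dependence on \<open>Q\<close> cancels.\<close>

lemma digit_sum_mult_power_minus_1:
  assumes "0 < Q" "Q \<le> g ^ j"
  shows "digit_sum g (Q * (g ^ j - 1)) = (g - 1) * j"
proof -
  have "Q * (g ^ j - 1) = g ^ j * (Q - 1) + (g ^ j - 1 - (Q - 1))"
  proof -
    obtain q where q: "Q = Suc q" using assms by (cases Q) auto
    obtain d where d: "g ^ j = q + 1 + d"
      using assms q by (metis Suc_eq_plus1 le_iff_add)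
    show ?thesis unfolding d q by (simp add: algebra_simps)
  qed
  then show ?thesis
    using digit_sum_power_mult_add[of "g ^ j - 1 - (Q - 1)" j "Q - 1"]
      digit_sum_complement[of "Q - 1" j] assms g2 by (simp add: add.commute)
qed

text \<open>The residue \<open>z\<close> has at most \<open>t\<close> digits; the missing digit sum
  is supplied by \<open>g ^ p * (Q * (g ^ j - 1))\<close>, invisible modulo \<open>Q\<close>. The
  lower bound on \<open>k\<close> forces \<open>t \<le> j\<close>, hence
  \<open>Q \<le> g ^ j\<close>; the shift by \<open>p\<close> keeps the blocks apart and controls
  the size of \<open>n\<close>.\<close>

lemma ex_cong_digit_sum:
  assumes Q: "0 < Q" "Q \<le> g ^ t" "(g - 1) dvd Q"
    and k: "2 * (g - 1) * t \<le> k" "0 < t" "[k = \<rho>] (mod (g - 1))"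
    and p: "t \<le> p"
  shows "\<exists>n. [n = \<rho>] (mod Q) \<and> digit_sum g n = k \<and> g ^ p \<le> n \<and> n < g ^ (p + t + k div (g - 1))"
proof -
  define z where "z = \<rho> mod Q"
  have zQ: "z < Q" using Q by (simp add: z_def)
  have z\<rho>: "[z = \<rho>] (mod Q)" by (simp add: z_def cong_def)
  have zt: "z < g ^ t" using zQ Q by simp
  have zo: "z < g ^ p" using zt p g2 power_increasing[of t p g] by linarith
  have dz: "digit_sum g z \<le> (g - 1) * t" by (rule digit_sum_le[OF zt])
  have dzk: "digit_sum g z \<le> k" using dz k(1) by simp
  have "[digit_sum g z = k] (mod (g - 1))"
    using cong_digit_sum[of z] z\<rho> Q(3) k(3) by (meson cong_dvd_modulus_nat cong_sym cong_trans)
  then have "(g - 1) dvd (k - digit_sum g z)"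
    using dzk by (simp add: cong_altdef_nat cong_sym_eq)
  then obtain j where j: "k - digit_sum g z = (g - 1) * j" by blast
  have "2 * (g - 1) * t = (g - 1) * t + (g - 1) * t" by simp
  then have "(g - 1) * t \<le> (g - 1) * j" using dz k(1) j dzk by linarith
  then have tj: "t \<le> j" using g2 by simp
  have Qj: "Q \<le> g ^ j" using Q(2) tj g2 power_increasing[of t j g] by linarith
  define E where "E = Q * (g ^ j - 1)"
  have gj: "1 < g ^ j" using tj k(2) g2 by (intro one_less_power) auto
  have E1: "1 \<le> E" using Q gj by (simp add: E_def)
  have "E < Q * g ^ j" using Q gj by (simp add: E_def)
  also have "\<dots> \<le> g ^ t * g ^ j" using Q by simp
  finally have Elt: "Suc E \<le> g ^ (t + j)" by (simp add: power_add)
  define n where "n = g ^ p * E + z"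
  have "digit_sum g n = (g - 1) * j + digit_sum g z"
    unfolding n_def using digit_sum_power_mult_add[OF zo, of E] digit_sum_mult_power_minus_1[OF Q(1) Qj]
    by (simp add: E_def)
  then have dn: "digit_sum g n = k" using j dzk by simp
  have "[n = z] (mod Q)" unfolding n_def E_def
    by (simp add: cong_def mult.left_commute[of _ Q])
  then have c: "[n = \<rho>] (mod Q)" using z\<rho> cong_trans by blast
  have lo: "g ^ p \<le> n" using E1 by (simp add: n_def trans_le_add1)
  have "n < g ^ p * Suc E" using zo by (simp add: n_def)
  also have "\<dots> \<le> g ^ p * g ^ (t + j)" using Elt by (intro mult_le_mono2)
  also have "\<dots> = g ^ (p + t + j)" by (simp add: power_add)
  also have "\<dots> \<le> g ^ (p + t + k div (g - 1))"
  proof -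
    have "(g - 1) * j \<le> k" using j by (metis diff_le_self)
    then have "j \<le> k div (g - 1)" using g2 by (simp add: less_eq_div_iff_mult_less_eq mult.commute)
    then show ?thesis using g2 by (intro power_increasing) auto
  qed
  finally show ?thesis using dn c lo by blast
qed

section \<open>Balanced splittings with a prescribed number of carries\<close>

text \<open>A splitting \<open>a + b + e = X\<close> with incoming carry \<open>e\<close>; the number \<open>c\<close> counts the
  carries of the addition, each of which costs \<open>g - 1\<close> in the digit sum.\<close>

definition balanced_split :: "nat \<Rightarrow> nat \<Rightarrow> nat \<Rightarrow> bool" where
  "balanced_split X e c \<longleftrightarrow> (\<exists>a b. a + b + e = X \<and>
     digit_sum g a + digit_sum g b + e = digit_sum g X + (g - 1) * c \<and>
     digit_sum g a \<le> digit_sum g b \<and> digit_sum g b \<le> digit_sum g a + 1)"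

lemma balanced_splitI:
  assumes "a + b + e = X" "digit_sum g a + digit_sum g b + e = digit_sum g X + (g - 1) * c"
    "digit_sum g a \<le> digit_sum g b + 1" "digit_sum g b \<le> digit_sum g a + 1"
  shows "balanced_split X e c"
proof (cases "digit_sum g a \<le> digit_sum g b")
  case True
  then show ?thesis using assms unfolding balanced_split_def by blast
next
  case False
  then show ?thesis using assms unfolding balanced_split_def
    by (intro exI[of _ b] exI[of _ a]) auto
qed

lemma balanced_split_0: "balanced_split 0 0 0"
  unfolding balanced_split_def by auto

text \<open>\<open>\<tau>\<close> is the sum of the two new lowest digits, \<open>e\<close> the
  carry entering and \<open>e'\<close> the carry leaving them. The larger half of
  \<open>\<tau>\<close> goes to the summand whose digit sum is not the larger one, so the imbalance
  stays at most 1.\<close>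

lemma balanced_split_digit:
  assumes s: "balanced_split X' e' c'" and x: "x < g" and \<tau>: "\<tau> + e = x + g * e'" "\<tau> \<le> 2 * (g - 1)"
  shows "balanced_split (g * X' + x) e (c' + e')"
proof -
  obtain a b where ab: "a + b + e' = X'"
    "digit_sum g a + digit_sum g b + e' = digit_sum g X' + (g - 1) * c'"
    "digit_sum g a \<le> digit_sum g b" "digit_sum g b \<le> digit_sum g a + 1"
    using s unfolding balanced_split_def by blast
  define p q where "p = \<tau> - \<tau> div 2" and "q = \<tau> div 2"
  have pq: "p + q = \<tau>" "q \<le> p" "p \<le> q + 1" by (auto simp: p_def q_def)
  have lt: "p < g" "q < g" using pq \<tau>(2) g2 by auto
  note d = digit_sum_mult_add[OF lt(1), of a] digit_sum_mult_add[OF lt(2), of b]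
    digit_sum_mult_add[OF x, of X']
  have ge: "g * e' = (g - 1) * e' + e'" using g2 by (cases g) auto
  show ?thesis
  proof (rule balanced_splitI[of "g * a + p" "g * b + q"])
    have "(g * a + p) + (g * b + q) + e = g * (a + b) + (\<tau> + e)"
      using pq by (simp add: algebra_simps)
    also have "\<dots> = g * X' + x" unfolding \<tau>(1) ab(1)[symmetric] by (simp add: algebra_simps)
    finally show "(g * a + p) + (g * b + q) + e = g * X' + x" .
    show "digit_sum g (g * a + p) + digit_sum g (g * b + q) + e
        = digit_sum g (g * X' + x) + (g - 1) * (c' + e')"
      using d ab(2) pq(1) \<tau>(1) ge by (simp add: add_mult_distrib2)
  qed (use d ab pq in auto)
qed

text \<open>Without incoming carry, a carry can leave the lowest digit only if that digit is at most
  \<open>g - 2\<close>. An incoming carry is forced through all trailing zeros of \<open>X\<close>,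
  so there must be at most \<open>c\<close> of them. The bound \<open>g ^ c \<le> X\<close> provides
  a digit to absorb the last carry.\<close>

lemma balanced_split_exists_aux:
  "((c = 0 \<or> X mod g \<le> g - 2) \<and> (c = 0 \<or> g ^ c \<le> X) \<longrightarrow> balanced_split X 0 c) \<and>
   (\<not> g ^ (c + 1) dvd X \<and> g ^ c \<le> X \<longrightarrow> balanced_split X 1 c)"
proof (induction X arbitrary: c rule: less_induct)
  case (less X)
  show ?case
  proof (cases "X = 0")
    case True
    then show ?thesis using balanced_split_0 g2 by auto
  next
    case False
    define Y x where "Y = X div g" and "x = X mod g"
    have X: "X = g * Y + x" and x: "x < g" using g2 by (auto simp: Y_def x_def)
    have "Y < X" using False g2 by (simp add: Y_def)
    note IH = less.IH[OF this]
    have IH0: "balanced_split Y 0 c'" if "c' = 0 \<or> Y mod g \<le> g - 2" "c' = 0 \<or> g ^ c' \<le> Y" for c'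
      using IH[of c'] that by blast
    have IH1: "balanced_split Y 1 c'" if "\<not> g ^ (c' + 1) dvd Y" "g ^ c' \<le> Y" for c'
      using IH[of c'] that by blast
    have pow: "g ^ c' \<le> Y" if "g ^ Suc c' \<le> X" for c'
      using that g2 unfolding Y_def by (simp add: less_eq_div_iff_mult_less_eq mult.commute)
    have dvd0: "balanced_split Y 0 (Suc c')" if "g ^ Suc c' dvd Y" "g ^ c' \<le> Y" for c'
    proof (rule IH0)
      have "0 < Y" using that(2) g2 by (metis le_zero_eq gr0I power_not_zero not_numeral_le_zero)
      then show "Suc c' = 0 \<or> g ^ Suc c' \<le> Y" using that(1) by (simp add: dvd_imp_le)
      have "g dvd Y" using that(1) by (metis dvd_mult_left power_Suc)
      then show "Suc c' = 0 \<or> Y mod g \<le> g - 2" by simp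
    qed
    have A: "balanced_split X 0 c" if h: "c = 0 \<or> X mod g \<le> g - 2" "c = 0 \<or> g ^ c \<le> X"
    proof (cases c)
      case 0
      then show ?thesis
        using balanced_split_digit[OF IH0[of 0] x, of x 0] X x by simp
    next
      case (Suc c')
      have xg: "x \<le> g - 2" using h Suc by (simp add: x_def)
      have le: "g ^ c' \<le> Y" using pow h Suc by blast
      \<comment> \<open>If \<open>Y\<close> ends in \<open>c' + 1\<close> zeros, a carry into
        \<open>Y\<close> would force more than \<open>c'\<close> further ones, so all carries are
        left to \<open>Y\<close>; otherwise one is made at once.\<close>
      show ?thesis
      proof (cases "g ^ Suc c' dvd Y")
        case True
        then show ?thesis
          using balanced_split_digit[OF dvd0[OF True le] x, of x 0] X x Suc by simp
      next
        case False
        then have "balanced_split Y 1 c'" using IH1 le by simp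
        then show ?thesis
          using balanced_split_digit[of Y 1 c' x "x + g" 0] x xg g2 X Suc by simp
      qed
    qed
    have B: "balanced_split X 1 c" if h: "\<not> g ^ (c + 1) dvd X" "g ^ c \<le> X"
    proof (cases c)
      case 0
      then have "x \<noteq> 0" using h by (auto simp: x_def dvd_eq_mod_eq_0)
      then show ?thesis
        using balanced_split_digit[OF IH0[of 0] x, of "x - 1" 1] X x 0 by simp
    next
      case (Suc c')
      have le: "g ^ c' \<le> Y" using pow h Suc by blast
      show ?thesis
      proof (cases "g ^ Suc c' dvd Y")
        case True
        have "x \<noteq> 0"
        proof
          assume "x = 0"
          then have "g * g ^ Suc c' dvd X" using True X by (simp add: mult_dvd_mono)
          then show False using h(1) Suc by simp
        qed
        then show ?thesis
          using balanced_split_digit[OF dvd0[OF True le] x, of "x - 1" 1] X x Suc by simp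
      next
        case False
        then have "balanced_split Y 1 c'" using IH1 le by simp
        then show ?thesis
          using balanced_split_digit[of Y 1 c' x "x + g - 1" 1] x g2 X Suc by simp
      qed
    qed
    show ?thesis using A B by blast
  qed
qed

lemma balanced_split_exists:
  assumes "X mod g \<le> g - 2" "g ^ c \<le> X" "digit_sum g X + (g - 1) * c = 2 * S"
  shows "\<exists>a b. a + b = X \<and> digit_sum g a = S \<and> digit_sum g b = S"
proof -
  have "balanced_split X 0 c" using balanced_split_exists_aux assms by blast
  then obtain a b where "a + b = X" "digit_sum g a + digit_sum g b = 2 * S"
    "digit_sum g a \<le> digit_sum g b" "digit_sum g b \<le> digit_sum g a + 1"
    unfolding balanced_split_def using assms(3) by auto
  then have "digit_sum g a = S" "digit_sum g b = S" by auto
  then show ?thesis using \<open>a + b = X\<close> by blast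
qed

section \<open>Controlling the borrow from the high digits\<close>

text \<open>Subtracting \<open>n\<close> may or may not borrow from the high digits of \<open>M\<close>, which can
  change the digit sum drastically; restricting the size of \<open>n\<close> to \<open>[g^p, g^(p + l))\<close> for a
  suitable \<open>p\<close> decides this beforehand.\<close>

lemma ex_borrow_independent_offset:
  assumes M: "g ^ (r + 2 * l) \<le> M"
  shows "\<exists>p h. r \<le> p \<and> p \<le> r + l \<and> h \<le> M \<and>
    (\<forall>n. g ^ p \<le> n \<and> n < g ^ (p + l) \<longrightarrow> (M - n) div g ^ (r + 2 * l) = h)"
proof -
  define G where "G = g ^ (r + 2 * l)"
  define P H where "P = M mod G" and "H = M div G"
  have G0: "0 < G" using g2 by (simp add: G_def)
  have MP: "M = G * H + P" and PG: "P < G" using G0 by (auto simp: P_def H_def)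
  have H0: "0 < H" using M G0 by (simp add: H_def G_def div_greater_zero_iff)
  have H: "H \<le> M" by (simp add: H_def)
  show ?thesis
  proof (cases "g ^ (r + l) \<le> P")
    case True
    have "(M - n) div G = H" if "n < g ^ (r + l)" for n
    proof -
      have "M - n = G * H + (P - n)" using that True MP by simp
      moreover have "P - n < G" using PG by simp
      ultimately show ?thesis using G0 by simp
    qed
    then show ?thesis using H unfolding G_def by (intro exI[of _ r] exI[of _ H]) auto
  next
    case False
    \<comment> \<open>Here \<open>P < n < G\<close>, so exactly one unit is borrowed from
      \<open>H\<close>.\<close>
    have "(M - n) div G = H - 1" if "g ^ (r + l) \<le> n" "n < G" for n
    proof -
      obtain H' where H': "H = Suc H'" using H0 by (cases H) auto
      have "M - n = G * H' + (G + P - n)" using that MP H' by simp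
      moreover have "G + P - n < G" using that False by simp
      ultimately show ?thesis using G0 H' by simp
    qed
    then show ?thesis using H unfolding G_def
      by (intro exI[of _ "r + l"] exI[of _ "H - 1"]) (auto simp: mult_2 add.assoc)
  qed
qed

section \<open>Splitting into two Niven numbers of digit sum \<open>D\<close>\<close>

lemma niven_sum_of_two:
  assumes D: "0 < D" "D * (g - 1) \<le> g ^ t" "coprime D (g - 1)" "0 < t"
    and X: "D dvd X" "X mod g ^ (4 * t + 1) = g ^ (4 * t) - 1" "g ^ (4 * t + c) \<le> X"
    and c: "digit_sum g X + (g - 1) * c = 2 * D"
  shows "\<exists>a b. niven g a \<and> niven g b \<and> X = a + b"
proof -
  define G where "G = g ^ (4 * t)"
  define Y where "Y = X div G"
  \<comment> \<open>The block of \<open>4 * t\<close> digits \<open>g - 1\<close> will give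
    \<open>2 * (g - 1) * t\<close> to each summand; \<open>S\<close> remains for the upper
    parts.\<close>
  define S where "S = D - 2 * (g - 1) * t"
  have G0: "0 < G" using g2 by (simp add: G_def)
  have gG: "g ^ (4 * t + 1) = G * g" by (simp add: G_def)
  have "X mod g ^ (4 * t + 1) = G * (Y mod g) + X mod G"
    unfolding gG Y_def by (rule mod_mult2_eq)
  then have eq: "G * (Y mod g) + X mod G = G - 1" using X(2) by (simp add: G_def)
  have Yg: "Y mod g = 0"
  proof (rule ccontr)
    assume "Y mod g \<noteq> 0"
    then have "G * 1 \<le> G * (Y mod g)" by (intro mult_le_mono2) simp
    then show False using eq G0 by linarith
  qed
  have XG: "X mod G = G - 1" using eq Yg by simp
  have XY: "X = G * Y + (G - 1)" using XG mult_div_mod_eq[of G X] by (simp add: Y_def)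
  have cY: "g ^ c \<le> Y"
    using X(3) G0 by (simp add: Y_def less_eq_div_iff_mult_less_eq power_add G_def mult.commute)
  have dX: "digit_sum g X = digit_sum g Y + (g - 1) * (4 * t)"
    using digit_sum_split[of X "4 * t"] digit_sum_power_minus_1[of "4 * t"] XG
    by (simp add: Y_def G_def)
  then have "digit_sum g Y + (g - 1) * c + 2 * (2 * (g - 1) * t) = 2 * D"
    using c by (simp add: algebra_simps)
  then have "digit_sum g Y + (g - 1) * c = 2 * S" and SD: "S + 2 * (g - 1) * t = D"
    by (auto simp: S_def)
  then obtain a b where ab: "a + b = Y" "digit_sum g a = S" "digit_sum g b = S"
    using balanced_split_exists[of Y c S] Yg cY by auto
  define k where "k = 2 * (g - 1) * t"
  define w where "w = D - (G * a) mod D"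
  have w: "[w + G * a = 0] (mod D)"
  proof -
    have "w + (G * a) mod D = D" using D(1) by (simp add: w_def less_imp_le)
    then have "(w + (G * a) mod D) mod D = 0" by simp
    then show ?thesis by (simp add: cong_def mod_add_right_eq)
  qed
  obtain \<rho> where \<rho>: "[\<rho> = w] (mod D)" "[\<rho> = k] (mod (g - 1))"
    using binary_chinese_remainder_nat[OF D(3)] by blast
  \<comment> \<open>With offset \<open>t\<close>, the bound on \<open>v\<close> is
    \<open>t + t + 2 * t\<close> digits, exactly the block length.\<close>
  have "\<exists>v. [v = \<rho>] (mod (D * (g - 1))) \<and> digit_sum g v = k \<and> g ^ t \<le> v \<and>
      v < g ^ (t + t + k div (g - 1))"
    using D g2 \<rho>(2) by (intro ex_cong_digit_sum) (auto simp: k_def cong_sym_eq)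
  then obtain v where v: "[v = \<rho>] (mod (D * (g - 1)))" "digit_sum g v = k"
      "v < g ^ (t + t + k div (g - 1))" by blast
  have "k div (g - 1) = 2 * t" using g2 by (simp add: k_def)
  then have vG: "v < G" using v(3) by (simp add: G_def mult_2[symmetric])
  have "[v = w] (mod D)" using v(1) \<rho>(1) by (meson cong_modulus_mult_nat cong_trans)
  then have "[v + G * a = 0] (mod D)" using w by (meson cong_add_rcancel_nat cong_trans)
  then have dvd1: "D dvd G * a + v" by (simp add: cong_0_iff add.commute)
  have sum: "X = (G * a + v) + (G * b + (G - 1 - v))"
    using XY ab(1)[symmetric] vG by (simp add: algebra_simps)
  then have dvd2: "D dvd G * b + (G - 1 - v)" using X(1) dvd1 dvd_add_right_iff by blast
  have s1: "digit_sum g (G * a + v) = D"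
    using digit_sum_power_mult_add[of v "4 * t" a] vG ab v(2) SD by (simp add: G_def k_def)
  have "digit_sum g (G - 1 - v) + k = (g - 1) * (4 * t)"
    using digit_sum_complement[of v "4 * t"] vG v(2) by (simp add: G_def)
  then have "digit_sum g (G - 1 - v) = k" by (simp add: k_def algebra_simps)
  then have s2: "digit_sum g (G * b + (G - 1 - v)) = D"
    using digit_sum_power_mult_add[of "G - 1 - v" "4 * t" b] G0 ab SD by (simp add: G_def k_def)
  have pos: "1 \<le> n" if "digit_sum g n = D" for n
    using that D(1) by (cases n) auto
  have "niven g (G * a + v)" "niven g (G * b + (G - 1 - v))"
    using s1 s2 dvd1 dvd2 pos unfolding niven_def by auto
  then show ?thesis using sum by blast
qed

section \<open>Choosing the first Niven number and the modulus \<open>D\<close>\<close>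

text \<open>The size of \<open>K\<close> relative to \<open>t\<close> leaves room for the low
  digits, the carries and the block, while the exponential hypothesis makes
  \<open>D * (g - 1)\<close> and \<open>k\<close> at most \<open>g ^ t\<close>.\<close>

lemma niven_sum_of_three:
  assumes t: "0 < t" "100 * g ^ 5 * (t + 1) \<le> g ^ t"
    and K: "100 * g ^ 3 * t \<le> K" "K < 100 * g ^ 3 * (t + 1)"
    and M: "g ^ K \<le> M" "M < g ^ (K + 1)"
  shows "\<exists>n1 n2 n3. niven g n1 \<and> niven g n2 \<and> niven g n3 \<and> M = n1 + n2 + n3"
proof -
  define s2 s3 where "s2 = g ^ 2 * t" and "s3 = g ^ 3 * t"
  have t_s2: "t \<le> s2" and s2_s3: "s2 \<le> s3"
    using g2 power_increasing[of 2 3 g] by (auto simp: s2_def s3_def)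
  have K1: "100 * s3 \<le> K" using K(1) by (simp add: s3_def)
  have t3: "1 \<le> s3" using t(1) g2 by (simp add: s3_def)
  have "K < g ^ K" using g2 by (simp add: less_exp power_gt_expt)
  then have M3: "3 \<le> M" using M(1) K1 t3 by linarith
  \<comment> \<open>Modulo \<open>g - 1\<close> this is \<open>M - 2\<close>, which gives
    \<open>X \<equiv> 2 \<equiv> 2 * D\<close>; modulo \<open>g\<close> it is 1, hence coprime to
    \<open>g\<close>. The term \<open>14 * t * (g - 1)\<close> meets the lower bound in
    \<open>ex_cong_digit_sum\<close> for \<open>7 * t\<close>.\<close>
  define k where "k = g * (14 * t * (g - 1) + (M - 3) mod (g - 1)) + 1"
  have k_cong: "[k + 2 = M] (mod (g - 1))"
  proof -
    have "[k + 2 = 1 * (14 * t * (g - 1) + (M - 3) mod (g - 1)) + 3] (mod (g - 1))"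
    proof -
      have "k + 2 = g * (14 * t * (g - 1) + (M - 3) mod (g - 1)) + 3" by (simp add: k_def)
      then show ?thesis using cong_base_1 by (metis cong_add cong_mult cong_refl)
    qed
    also have "[1 * (14 * t * (g - 1) + (M - 3) mod (g - 1)) + 3 = (M - 3) + 3] (mod (g - 1))"
      by (intro cong_add cong_refl) (simp add: cong_def)
    finally show ?thesis using M3 by simp
  qed
  have k0: "0 < k" by (simp add: k_def)
  have k_ge: "2 * (g - 1) * (7 * t) \<le> k"
  proof -
    have "1 * (14 * t * (g - 1)) \<le> g * (14 * t * (g - 1) + (M - 3) mod (g - 1))"
      using g2 by (intro mult_le_mono) auto
    then show ?thesis by (simp add: k_def mult.commute mult.left_commute)
  qed
  have k_le: "k \<le> 15 * s2"
  proof -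
    have m: "(M - 3) mod (g - 1) \<le> t * (g - 1)"
    proof -
      have "(M - 3) mod (g - 1) \<le> 1 * (g - 1)" using g2 by (simp add: less_imp_le)
      also have "\<dots> \<le> t * (g - 1)" using t(1) by (intro mult_le_mono1) simp
      finally show ?thesis .
    qed
    have "k \<le> g * (14 * t * (g - 1) + t * (g - 1)) + 1"
      unfolding k_def using m by simp
    also have "\<dots> = 15 * t * g * (g - 1) + 1" by (simp add: algebra_simps)
    also have "\<dots> \<le> 15 * t * g * (g - 1) + 15 * t * g" using t(1) g2 by simp
    also have "\<dots> = 15 * t * g * ((g - 1) + 1)" by (simp only: distrib_left mult_1_right)
    also have "\<dots> = 15 * s2" using g2 by (simp add: s2_def power2_eq_square)
    finally show ?thesis .
  qed
  \<comment> \<open>\<open>g ^ (p + l)\<close> dominates the bound on \<open>n\<close> from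
    \<open>ex_cong_digit_sum\<close>; above the lowest \<open>U\<close> digits, \<open>M - n\<close>
    will not depend on \<open>n\<close>.\<close>
  define l where "l = 7 * t + k"
  define U where "U = 7 * t + 2 * l"
  have U_le: "U \<le> 51 * s2"
  proof -
    have "U = 21 * t + 2 * k" by (simp add: U_def l_def)
    also have "\<dots> \<le> 21 * s2 + 2 * (15 * s2)"
      using t_s2 k_le by (intro add_mono mult_le_mono2)
    finally show ?thesis by simp
  qed
  have gk: "2 * g * k \<le> 30 * s3"
  proof -
    have "2 * g * k \<le> 2 * g * (15 * s2)" using k_le by (intro mult_le_mono2)
    then show ?thesis by (simp add: s2_def s3_def power2_eq_square power3_eq_cube algebra_simps)
  qed
  \<comment> \<open>In units of \<open>g - 1\<close>: the low digits, the rounding in the choice of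
    \<open>D\<close>, and the block with its zero.\<close>
  have room: "U + 2 * g * k + 2 + (4 * t + 1) \<le> K"
    using U_le gk t_s2 s2_s3 K1 t3 by linarith
  have UK: "U < K" using room by simp
  have "g ^ U \<le> g ^ K" using UK g2 by (intro power_increasing) auto
  then have "g ^ U \<le> M" using M(1) by simp
  then obtain p h where p: "7 * t \<le> p" "p \<le> 7 * t + l" and hM: "h \<le> M"
    and h: "\<And>n. g ^ p \<le> n \<Longrightarrow> n < g ^ (p + l) \<Longrightarrow> (M - n) div g ^ U = h"
    using ex_borrow_independent_offset[of "7 * t" l M] unfolding U_def by blast
  have dh: "digit_sum g h \<le> (g - 1) * (K + 1)"
    using hM M(2) by (intro digit_sum_le) simp

  \<comment> \<open>\<open>A\<close> bounds the digit sum of every candidate \<open>M - n\<close>, so \<open>A < 2 D\<close> leaves a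
    nonnegative number of carries; \<open>D \<equiv> 1\<close> modulo \<open>m\<close> makes the moduli coprime.\<close>
  define m where "m = g * (k * (g - 1))"
  define A where "A = digit_sum g h + (g - 1) * U"
  define D where "D = m * (A div (2 * m) + 1) + 1"
  have m0: "0 < m" using g2 k0 by (simp add: m_def)
  have D_A: "A < 2 * D" "2 * D \<le> A + 2 * m + 2"
  proof -
    have e: "2 * D = 2 * m * (A div (2 * m)) + 2 * m + 2" by (simp add: D_def algebra_simps)
    have "A = 2 * m * (A div (2 * m)) + A mod (2 * m)" by simp
    moreover have "A mod (2 * m) < 2 * m" using m0 by simp
    ultimately show "A < 2 * D" "2 * D \<le> A + 2 * m + 2" using e by linarith+
  qed
  have "(g - 1) * (U + 2 * g * k + 2 + (4 * t + 1)) \<le> (g - 1) * K"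
    using room by (rule mult_le_mono2)
  then have room': "(g - 1) * U + 2 * m + 2 * (g - 1) + (g - 1) * (4 * t + 1) \<le> (g - 1) * K"
    by (simp add: m_def distrib_left mult_ac)
  \<comment> \<open>\<open>digit_sum g h\<close> stays on the right: it later cancels against the
    high part of \<open>digit_sum g X\<close>, so the carry count is bounded whatever
    \<open>h\<close> is.\<close>
  have D_le: "2 * D + (g - 1) * (4 * t + 1) \<le> digit_sum g h + (g - 1) * K"
    using D_A(2) room' g2 unfolding A_def by linarith
  have "2 * D \<le> (g - 1) * (2 * K)"
    using D_le dh by (simp add: distrib_left mult_2_right)
  then have DK: "D \<le> (g - 1) * K" by simp
  have "D * (g - 1) \<le> ((g - 1) * K) * (g - 1)" using DK by (rule mult_le_mono1)
  also have "\<dots> \<le> (g * K) * g" by (intro mult_le_mono) auto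
  also have "\<dots> = g ^ 2 * K" by (simp add: power2_eq_square)
  also have "\<dots> \<le> g ^ 2 * (100 * g ^ 3 * (t + 1))" using K(2) by simp
  also have "\<dots> = 100 * g ^ 5 * (t + 1)" by (simp add: algebra_simps flip: power_add)
  also have "\<dots> \<le> g ^ t" by (rule t(2))
  finally have Dg: "D * (g - 1) \<le> g ^ t" .
  have kt: "k \<le> g ^ t"
  proof -
    have "s2 \<le> g ^ 5 * (t + 1)"
      unfolding s2_def using g2 by (intro mult_le_mono power_increasing) auto
    then show ?thesis using k_le t(2) by linarith
  qed
  have D0: "0 < D" by (simp add: D_def)
  have Dm: "coprime D m"
    unfolding D_def by (rule coprime_mult_add_one_nat)
  then have D_cop: "coprime D g" "coprime D (k * (g - 1))" "coprime D (g - 1)"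
    unfolding m_def by auto
  have kg: "coprime (k * (g - 1)) g"
  proof -
    have "coprime k g" unfolding k_def by (rule coprime_mult_add_one_nat)
    moreover have "coprime (g - 1) g" using g2 coprime_diff_one_left_nat by simp
    ultimately show ?thesis by simp
  qed
  define G where "G = g ^ (4 * t)"
  have GM: "G \<le> M"
  proof -
    have "G \<le> g ^ K" unfolding G_def using room g2 by (intro power_increasing) auto
    then show ?thesis using M(1) by simp
  qed
  define Q where "Q = D * (k * (g - 1)) * g ^ (4 * t + 1)"
  \<comment> \<open>The single congruence modulo \<open>k * (g - 1)\<close> yields both
    \<open>k dvd n\<close> and \<open>n \<equiv> k\<close> modulo \<open>g - 1\<close>, moduli that
    need not be coprime.\<close>
  obtain x where x: "[x = M] (mod D)" "[x = k] (mod (k * (g - 1)))"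
    using binary_chinese_remainder_nat[OF D_cop(2)] by blast
  have "coprime (D * (k * (g - 1))) (g ^ (4 * t + 1))"
    using D_cop(1) kg by (simp del: power_Suc)
  then obtain \<rho> where \<rho>: "[\<rho> = x] (mod (D * (k * (g - 1))))"
      "[\<rho> = M - (G - 1)] (mod g ^ (4 * t + 1))"
    using binary_chinese_remainder_nat by blast
  have \<rho>D: "[\<rho> = M] (mod D)"
    using \<rho>(1) x(1) by (meson cong_modulus_mult_nat cong_trans)
  have \<rho>k': "[\<rho> = k] (mod (k * (g - 1)))"
    using \<rho>(1) x(2) by (metis cong_modulus_mult_nat cong_trans mult.commute)
  have \<rho>k: "[k = \<rho>] (mod (g - 1))"
    using \<rho>k' by (metis cong_modulus_mult_nat cong_sym mult.commute)
  have \<rho>0: "[\<rho> = 0] (mod k)"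
    using \<rho>k' by (metis cong_modulus_mult_nat cong_trans cong_mult_self_left cong_0_iff dvd_refl)
  \<comment> \<open>The factors take \<open>t\<close>, \<open>t\<close> and \<open>4 * t + 1\<close>
    digits, whence the \<open>7 * t\<close> above.\<close>
  have "Q = (D * (g - 1)) * k * g ^ (4 * t + 1)" by (simp add: Q_def mult_ac)
  also have "\<dots> \<le> g ^ t * g ^ t * g ^ (4 * t + 1)"
    using Dg kt by (intro mult_le_mono) auto
  also have "\<dots> = g ^ (6 * t + 1)" by (simp add: power_add[symmetric])
  also have "\<dots> \<le> g ^ (7 * t)" using t(1) g2 by (intro power_increasing) auto
  finally have Q_le: "Q \<le> g ^ (7 * t)" .
  have "\<exists>n. [n = \<rho>] (mod Q) \<and> digit_sum g n = k \<and> g ^ p \<le> n \<and>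
      n < g ^ (p + 7 * t + k div (g - 1))"
    using Q_le k_ge t(1) \<rho>k p(1) D0 k0 g2 by (intro ex_cong_digit_sum) (auto simp: Q_def)
  then obtain n where n: "[n = \<rho>] (mod Q)" "digit_sum g n = k" "g ^ p \<le> n"
      "n < g ^ (p + 7 * t + k div (g - 1))" by blast
  have "g ^ (p + 7 * t + k div (g - 1)) \<le> g ^ (p + l)"
    using g2 by (intro power_increasing) (auto simp: l_def)
  then have n_lt: "n < g ^ (p + l)" using n(4) by simp
  also have "\<dots> \<le> g ^ (K - 1)"
    using p(2) UK g2 by (intro power_increasing) (auto simp: U_def)
  finally have nK: "n < g ^ (K - 1)" .
  have gK: "2 * g ^ (K - 1) \<le> g ^ K"
    using UK g2 by (cases K) auto
  define X where "X = M - n"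
  have MX: "M = X + n" and XK: "g ^ (K - 1) \<le> X" using nK gK M(1) by (auto simp: X_def)
  have nD: "[n = M] (mod D)"
    using n(1) \<rho>D unfolding Q_def by (metis cong_modulus_mult_nat cong_trans mult.assoc)
  have nk: "[n = 0] (mod k)"
    using n(1) \<rho>0 unfolding Q_def by (metis cong_modulus_mult_nat cong_trans mult.assoc mult.commute)
  have nG: "[n = M - (G - 1)] (mod g ^ (4 * t + 1))"
    using n(1) \<rho>(2) unfolding Q_def by (metis cong_modulus_mult_nat cong_trans mult.commute)
  have DX: "D dvd X"
    using nD MX by (metis cong_0_iff cong_add_rcancel_0_nat cong_sym)
  have XG: "X mod g ^ (4 * t + 1) = g ^ (4 * t) - 1"
  proof -
    have "M = (G - 1) + (M - (G - 1))" using GM by simp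
    then have "[X + n = (G - 1) + n] (mod g ^ (4 * t + 1))"
      using nG MX by (metis cong_add_lcancel_nat cong_sym)
    then have "[X = G - 1] (mod g ^ (4 * t + 1))" by (simp add: cong_add_rcancel_nat)
    moreover have "G - 1 < g ^ (4 * t + 1)"
    proof -
      have "G - 1 < G" using g2 by (simp add: G_def)
      also have "G \<le> g ^ (4 * t + 1)" unfolding G_def using g2 by (intro power_increasing) auto
      finally show ?thesis .
    qed
    ultimately show ?thesis by (simp add: cong_def G_def)
  qed
  have "X div g ^ U = h" unfolding X_def using h n(3) n_lt by blast
  then have sX: "digit_sum g X = digit_sum g h + digit_sum g (X mod g ^ U)"
    using digit_sum_split[of X U] by simp
  have "digit_sum g (X mod g ^ U) \<le> (g - 1) * U" using g2 by (intro digit_sum_le) simp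
  then have sX_lt: "digit_sum g X < 2 * D" using sX D_A(1) by (simp add: A_def)
  have X2: "[X = 2] (mod (g - 1))"
  proof -
    have "[k = n] (mod (g - 1))" using cong_digit_sum[of n] n(2) by simp
    then have "[X + k = X + n] (mod (g - 1))" by (simp add: cong_add_lcancel_nat)
    then have "[X + k = 2 + k] (mod (g - 1))"
      using k_cong MX by (metis add.commute cong_sym cong_trans)
    then show ?thesis by (simp only: cong_add_rcancel_nat)
  qed
  have "(g - 1) dvd m * (A div (2 * m) + 1)" unfolding m_def by (intro dvd_mult2 dvd_mult) simp
  then have "[D = 0 + 1] (mod (g - 1))"
    unfolding D_def by (intro cong_add cong_refl) (simp only: cong_0_iff)
  then have "[D = 1] (mod (g - 1))" by simp
  then have "[2 * D = 2 * 1] (mod (g - 1))" by (intro cong_mult cong_refl)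
  then have "[2 * D = digit_sum g X] (mod (g - 1))"
    using X2 cong_digit_sum[of X] by (metis cong_sym cong_trans mult_1_right)
  then have "(g - 1) dvd (2 * D - digit_sum g X)"
    using sX_lt by (simp add: cong_altdef_nat)
  then obtain c where c: "2 * D - digit_sum g X = (g - 1) * c" by blast
  then have c_eq: "digit_sum g X + (g - 1) * c = 2 * D" using sX_lt by simp
  \<comment> \<open>Since \<open>X\<close> is at least \<open>g ^ (K - 1)\<close>, this leaves
    enough digits above the block for all \<open>c\<close> carries.\<close>
  have "(g - 1) * (c + (4 * t + 1)) \<le> (g - 1) * K"
    using c_eq D_le sX by (simp add: distrib_left)
  then have "c + (4 * t + 1) \<le> K" using g2 by (simp only: mult_le_cancel1)
  then have "4 * t + c \<le> K - 1" by simp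
  then have "g ^ (4 * t + c) \<le> g ^ (K - 1)" using g2 by (intro power_increasing) auto
  then have "g ^ (4 * t + c) \<le> X" using XK by simp
  then obtain a b where ab: "niven g a" "niven g b" "X = a + b"
    using niven_sum_of_two[OF D0 Dg D_cop(3) t(1) DX XG _ c_eq] by blast
  have "n \<ge> 1" using n(2) k0 by (cases n) auto
  then have "niven g n" using nk n(2) by (simp add: niven_def cong_0_iff)
  then show ?thesis using ab MX by (metis add.commute)
qed

section \<open>Growth estimate and choice of the threshold\<close>

text \<open>Halving the exponent leaves two factors \<open>2 ^ s\<close>: one absorbs the constant,
  the other the linear factor.\<close>

lemma linear_le_power:
  assumes "4 * C \<le> t"
  shows "C * (t + 1) \<le> g ^ t"
proof -
  define s where "s = t div 2"
  have s: "2 * s \<le> t" "t + 1 \<le> 2 * (s + 1)" "2 * C \<le> s + 1" using assms by (auto simp: s_def)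
  have "C * (t + 1) \<le> (2 * C) * (s + 1)" using s(2) mult_le_mono2[of "t + 1" "2 * (s + 1)" C] by simp
  also have "\<dots> \<le> (s + 1) * (s + 1)" using s(3) by (rule mult_le_mono1)
  also have "\<dots> \<le> 2 ^ s * 2 ^ s" by (intro mult_le_mono) (simp_all add: Suc_leI)
  also have "\<dots> = 2 ^ (2 * s)" by (simp add: power_add[symmetric] mult_2)
  also have "\<dots> \<le> 2 ^ t" using s(1) by (intro power_increasing) auto
  also have "\<dots> \<le> g ^ t" using g2 by (rule power_mono) simp
  finally show ?thesis .
qed

end

theorem theorem1p1:
  fixes g :: nat
  assumes "g \<ge> 3"
  shows "\<exists>N0::nat. \<forall>M\<ge>N0. \<exists>n1 n2 n3.
           niven g n1 \<and> niven g n2 \<and> niven g n3 \<and> M = n1 + n2 + n3"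
proof -
  have g2: "g \<ge> 2" using assms by simp
  define C where "C = 100 * g ^ 3"
  \<comment> \<open>From here on \<open>linear_le_power\<close> applies with the constant
    \<open>100 * g ^ 5\<close>.\<close>
  define T where "T = 4 * (100 * g ^ 5) + 1"
  have C0: "0 < C" using g2 by (simp add: C_def)
  have "\<exists>n1 n2 n3. niven g n1 \<and> niven g n2 \<and> niven g n3 \<and> M = n1 + n2 + n3"
    if M: "g ^ (C * T) \<le> M" for M
  proof -
    have "0 < M" using M g2 by (auto intro: less_le_trans[rotated])
    then obtain K where K: "g ^ K \<le> M" "M < g ^ (K + 1)"
      using ex_power_ivl1[of g M] g2 by auto
    have "g ^ (C * T) < g ^ (K + 1)" using M K(2) by simp
    then have "C * T < K + 1" using g2 by (subst (asm) power_strict_increasing_iff) auto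
    then have "C * T \<le> K" by simp
    define t where "t = K div C"
    have tT: "T \<le> t" unfolding t_def
      using \<open>C * T \<le> K\<close> C0 by (simp add: less_eq_div_iff_mult_less_eq mult.commute)
    have "K < C * (t + 1)"
      using C0 dividend_less_times_div[of C K] by (simp add: t_def)
    moreover have "C * t \<le> K" by (simp add: t_def)
    moreover have "100 * g ^ 5 * (t + 1) \<le> g ^ t"
      using tT by (intro linear_le_power[OF g2]) (simp add: T_def)
    moreover have "0 < t" using tT by (simp add: T_def)
    ultimately show ?thesis
      using K by (intro niven_sum_of_three[OF g2, of t K]) (auto simp: C_def)
  qed
  then show ?thesis by blast
qed

end
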